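(* Let $X$ be a Banach space. For every $\rho\in\mathbb{U}_{\infty}$, the space $PAA(X,\rho)$ of $\rho$-pseudo almost automorphic functions is a Banach space under the supremum norm $\|f\|=\sup_{t\in\mathbb{R}}\|f(t)\|$.
   Context: $X$ is a Banach space and $BC(\mathbb{R},X)$ is the Banach space of all bounded continuous functions $f:\mathbb{R}\to X$ with the supremum norm. $\mathbb{U}$ is the set of functions (weights) $\rho:\mathbb{R}\to[0,+\infty)$ that are locally integrable over $\mathbb{R}$. For $\rho\in\mathbb{U}$ and $r>0$, put $\mu(r,\rho):=\int_{-r}^{r}\rho(t)\,dt$, and let $\mathbb{U}_{\infty}:=\{\rho\in\mathbb{U}:\lim_{r\to+\infty}\mu(r,\rho)=+\infty\}$. A continuous function $f:\mathbb{R}\to X$ is almost automorphic if for every real sequence $(s_m)$ there exists a subsequence $(s_n)$ such that $g(t):=\lim_{n\to\infty}f(t+s_n)$ is well defined for each $t\in\mathbb{R}$ and $\lim_{n\to\infty}g(t-s_n)=f(t)$ for each $t\in\mathbb{R}$. The set of all such functions is denoted by $AA(X)$. For $\rho\in\mathbb{U}_{\infty}$, $M_0(X,\rho):=\{f\in BC(\mathbb{R},X):\lim_{r\to+\infty}\frac{1}{\mu(r,\rho)}\int_{-r}^{r}\|f(t)\|\rho(t)\,dt=0\}$. For $\rho\in\mathbb{U}_{\infty}$, a function $f\in BC(\mathbb{R},X)$ is called $\rho$-pseudo almost automorphic (weighted pseudo almost automorphic) if it can be expressed as $f=g+h$ with $g\in AA(X)$ and $h\in M_0(X,\rho)$. The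 set of all such functions is denoted by $PAA(X,\rho)$. *)

theory Defs
  imports "HOL-Analysis.Analysis"
begin

text \<open>
  The Banach space \<open>BC(\<real>,X)\<close> with the supremum norm is the library type
  \<^typ>\<open>real \<Rightarrow>\<^sub>C 'a::banach\<close>. All integrals are Lebesgue integrals.
\<close>

definition weights :: "(real \<Rightarrow> real) set" where
  "weights = {\<rho>. (\<forall>t. 0 \<le> \<rho> t) \<and> (\<forall>K. compact K \<longrightarrow> set_integrable lebesgue K \<rho>)}"

definition weight_mass :: "real \<Rightarrow> (real \<Rightarrow> real) \<Rightarrow> real" where
  "weight_mass r \<rho> = (LINT t:{-r..r}|lebesgue. \<rho> t)"

definition weights_infty :: "(real \<Rightarrow> real) set" where
  "weights_infty = {\<rho> \<in> weights. filterlim (\<lambda>r. weight_mass r \<rho>) at_top at_top}"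

definition AA :: "(real \<Rightarrow> 'a::banach) set" where
  "AA = {f. continuous_on UNIV f \<and>
     (\<forall>s :: nat \<Rightarrow> real. \<exists>k :: nat \<Rightarrow> nat. strict_mono k \<and>
       (\<exists>g. (\<forall>t. (\<lambda>n. f (t + s (k n))) \<longlonglongrightarrow> g t) \<and>
            (\<forall>t. (\<lambda>n. g (t - s (k n))) \<longlonglongrightarrow> f t)))}"

definition M0 :: "(real \<Rightarrow> real) \<Rightarrow> (real \<Rightarrow>\<^sub>C 'a::banach) set" where
  "M0 \<rho> = {f. ((\<lambda>r. 1 / weight_mass r \<rho> *
       (LINT t:{-r..r}|lebesgue. norm (apply_bcontfun f t) * \<rho> t)) \<longlongrightarrow> 0) at_top}"

definition PAA :: "(real \<Rightarrow> real) \<Rightarrow> (real \<Rightarrow>\<^sub>C 'a::banach) set" where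
  "PAA \<rho> = {f. \<exists>g \<in> AA. \<exists>h \<in> M0 \<rho>.
       \<forall>t. apply_bcontfun f t = g t + apply_bcontfun h t}"

end

theory Submission
  imports Defs "HOL-Library.Diagonal_Subsequence"
begin

text \<open>
  Almost automorphic functions and weighted ergodic perturbations are both closed subspaces of the
  Banach space of bounded continuous functions, and the point is that their sum is closed too.
  For a general weight the two spaces may intersect nontrivially, so the decomposition \<open>f = g + h\<close>
  is not unique and \<open>\<parallel>g\<parallel>\<close> need not be controlled by \<open>\<parallel>f\<parallel>\<close>. It can, however, be \<^emph>\<open>chosen\<close> with
  such a control. Let \<open>c \<ge> \<parallel>f\<parallel>\<close> and let \<open>P\<close> be the radial retraction of \<open>X\<close> onto its ball of
  radius \<open>c\<close>. Then \<open>P \<circ> g\<close> is almost automorphic because \<open>P\<close> is continuous, it is bounded by \<open>c\<close>, and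
  \<open>f - P \<circ> g = P \<circ> f - P \<circ> g\<close> is dominated by \<open>2\<parallel>f - g\<parallel> = 2\<parallel>h\<parallel>\<close> because \<open>P\<close> is 2-Lipschitz; hence it
  is again ergodic (lemma \<open>bounded_decomposition\<close>).

  Such bounded decompositions make the sum of two closed subspaces closed (lemma
  \<open>closed_sum_of_subspaces\<close>): a point of the closure is written as a rapidly convergent series in
  the sum, whose terms are decomposed separately, and the almost automorphic parts are
  then absolutely summable. This is the argument by which the sum of a
  C*-subalgebra and a closed ideal is closed, with the radial retraction in the place of the
  functional calculus.
\<close>

section \<open>Sums of closed subspaces\<close>

text \<open>
  The bound on the first component is what prevents the components of a convergent sequence from
  diverging while their sum converges.
\<close>

lemma closed_sum_of_subspaces:
  fixes S M :: "'b::banach set"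
  assumes S: "subspace S" "closed S" and M: "subspace M" "closed M"
    and bounded: "\<And>c f. \<lbrakk>c > 0; f \<in> {g + h | g h. g \<in> S \<and> h \<in> M}; norm f \<le> c\<rbrakk>
      \<Longrightarrow> \<exists>g\<in>S. norm g \<le> c \<and> f - g \<in> M"
  shows "closed {g + h | g h. g \<in> S \<and> h \<in> M}"
proof -
  define T where "T = {g + h | g h. g \<in> S \<and> h \<in> M}"
  have T: "subspace T"
    using subspace_sums[OF S(1) M(1)] by (simp add: T_def)
  have "F \<in> T" if F: "F \<in> closure T" for F
  proof -
    \<comment> \<open>Half of \<open>(1/2)^n\<close>, so that consecutive approximants differ by at most \<open>(1/2)^n\<close>.\<close>
    have "\<exists>f\<in>T. dist f F < (1/2)^n / 2" for n
      using F[unfolded closure_approachable, rule_format, of "(1/2)^n / 2"] by simp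
    then obtain f where fT: "\<And>n. f n \<in> T" and fF: "\<And>n. dist (f n) F < (1/2)^n / 2"
      by metis
    have "norm (f (Suc n) - f n) \<le> (1/2)^n" for n
    proof -
      have "norm (f (Suc n) - f n) \<le> dist (f (Suc n)) F + dist (f n) F"
        by (metis dist_norm dist_triangle2)
      also have "\<dots> \<le> (1/2)^(Suc n) / 2 + (1/2)^n / 2"
        using fF[of n] fF[of "Suc n"] by linarith
      also have "\<dots> \<le> (1/2)^n" by simp
      finally show ?thesis .
    qed
    then have "\<exists>g\<in>S. norm g \<le> (1/2)^n \<and> (f (Suc n) - f n) - g \<in> M" for n
      using bounded[folded T_def] subspace_diff[OF T fT fT] by simp
    then obtain g where gS: "\<And>n. g n \<in> S" and g_le: "\<And>n. norm (g n) \<le> (1/2)^n"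
      and gM: "\<And>n. (f (Suc n) - f n) - g n \<in> M"
      by metis
    \<comment> \<open>The initial term of the series is decomposed arbitrarily: one term does not affect convergence.\<close>
    obtain g0 where g0: "g0 \<in> S" "f 0 - g0 \<in> M"
      using fT[of 0] by (auto simp: T_def)
    have "summable g"
      by (rule summable_comparison_test'[of "\<lambda>n. (1/2)^n" 0]) (use g_le in auto)
    then have lim_g: "(\<lambda>n. g0 + sum g {..<n}) \<longlonglongrightarrow> g0 + suminf g"
      by (intro tendsto_add tendsto_const summable_LIMSEQ)
    have "g0 + sum g {..<n} \<in> S" for n
      by (intro subspace_add[OF S(1)] g0 subspace_sum[OF S(1)] gS)
    then have G: "g0 + suminf g \<in> S"
      by (rule closed_sequentially[OF S(2) _ lim_g])
    have "(\<lambda>n. (1/2)^n / 2 :: real) \<longlonglongrightarrow> 0"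
      by (intro tendsto_divide_zero LIMSEQ_power_zero) simp
    then have "(\<lambda>n. f n - F) \<longlonglongrightarrow> 0"
      by (rule Lim_null_comparison[rotated])
        (use fF in \<open>auto simp: dist_norm intro!: always_eventually less_imp_le\<close>)
    then have lim_f: "f \<longlonglongrightarrow> F"
      by (simp add: LIM_zero_iff)
    \<comment> \<open>Telescoping: what remains of \<open>f n\<close> is a finite sum of \<open>M\<close>-components.\<close>
    have in_M: "f n - (g0 + sum g {..<n}) \<in> M" for n
    proof (induction n)
      case 0
      show ?case using g0 by simp
    next
      case (Suc n)
      have "f (Suc n) - (g0 + sum g {..<Suc n})
          = (f n - (g0 + sum g {..<n})) + ((f (Suc n) - f n) - g n)"
        by simp
      then show ?case
        using subspace_add[OF M(1) Suc gM[of n]] by metis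
    qed
    have H: "F - (g0 + suminf g) \<in> M"
      using closed_sequentially[OF M(2) in_M tendsto_diff[OF lim_f lim_g]] .
    show ?thesis
      unfolding T_def using G H
      by (intro CollectI exI[of _ "g0 + suminf g"] exI[of _ "F - (g0 + suminf g)"]) simp
  qed
  then have "closed T"
    using closure_subset_eq by blast
  then show ?thesis
    by (simp add: T_def)
qed

instance bcontfun :: (metric_space, banach) banach ..

section \<open>Almost automorphic functions\<close>

definition automorphic_along :: "(nat \<Rightarrow> real) \<Rightarrow> (real \<Rightarrow> 'a::banach) \<Rightarrow> bool" where
  "automorphic_along s f \<longleftrightarrow>
     (\<exists>g. (\<forall>t. (\<lambda>n. f (t + s n)) \<longlonglongrightarrow> g t) \<and> (\<forall>t. (\<lambda>n. g (t - s n)) \<longlonglongrightarrow> f t))"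

lemma AA_iff:
  "f \<in> AA \<longleftrightarrow> continuous_on UNIV f \<and> (\<forall>s :: nat \<Rightarrow> real. \<exists>k. strict_mono k \<and> automorphic_along (s \<circ> k) f)"
  by (simp add: AA_def automorphic_along_def)

lemma automorphic_along_subseq:
  assumes "automorphic_along s f" "strict_mono (k :: nat \<Rightarrow> nat)"
  shows "automorphic_along (s \<circ> k) f"
proof -
  from assms(1) obtain g where g: "\<And>t. (\<lambda>n. f (t + s n)) \<longlonglongrightarrow> g t"
    "\<And>t. (\<lambda>n. g (t - s n)) \<longlonglongrightarrow> f t"
    unfolding automorphic_along_def by blast
  show ?thesis
    unfolding automorphic_along_def
    using LIMSEQ_subseq_LIMSEQ[OF g(1) assms(2)] LIMSEQ_subseq_LIMSEQ[OF g(2) assms(2)]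
    by (auto simp: o_def)
qed

lemma automorphic_along_offset:
  assumes "automorphic_along (s \<circ> (+) m) f"
  shows "automorphic_along s f"
proof -
  from assms obtain g where g: "\<And>t. (\<lambda>n. f (t + s (n + m))) \<longlonglongrightarrow> g t"
    "\<And>t. (\<lambda>n. g (t - s (n + m))) \<longlonglongrightarrow> f t"
    unfolding automorphic_along_def by (auto simp: add.commute)
  show ?thesis
    unfolding automorphic_along_def using LIMSEQ_offset[OF g(1)] LIMSEQ_offset[OF g(2)] by blast
qed

lemma automorphic_along_add:
  assumes "automorphic_along s f" "automorphic_along s f'"
  shows "automorphic_along s (\<lambda>t. f t + f' t)"
proof -
  from assms obtain g g' where
    "\<And>t. (\<lambda>n. f (t + s n)) \<longlonglongrightarrow> g t" "\<And>t. (\<lambda>n. g (t - s n)) \<longlonglongrightarrow> f t"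
    "\<And>t. (\<lambda>n. f' (t + s n)) \<longlonglongrightarrow> g' t" "\<And>t. (\<lambda>n. g' (t - s n)) \<longlonglongrightarrow> f' t"
    unfolding automorphic_along_def by blast
  then show ?thesis
    unfolding automorphic_along_def
    by (intro exI[of _ "\<lambda>t. g t + g' t"]) (auto intro!: tendsto_add)
qed

lemma automorphic_along_compose:
  assumes "automorphic_along s f" "continuous_on UNIV P"
  shows "automorphic_along s (\<lambda>t. P (f t))"
proof -
  from assms(1) obtain g where
    "\<And>t. (\<lambda>n. f (t + s n)) \<longlonglongrightarrow> g t" "\<And>t. (\<lambda>n. g (t - s n)) \<longlonglongrightarrow> f t"
    unfolding automorphic_along_def by blast
  then show ?thesis
    unfolding automorphic_along_def
    by (intro exI[of _ "\<lambda>t. P (g t)"]) (auto intro: continuous_on_tendsto_compose[OF assms(2)])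
qed

text \<open>
  The translation limits \<open>g\<^sub>m\<close> of \<open>f\<^sub>m\<close> inherit the uniform Cauchy property of the \<open>f\<^sub>m\<close>, and
  both limit relations then survive the interchange of two limits one of which is uniform.
\<close>

lemma automorphic_along_uniform_limit:
  assumes along: "\<And>m. automorphic_along s (f m)"
    and unif: "uniform_limit UNIV f F sequentially"
  shows "automorphic_along s F"
proof -
  from along obtain g where g: "\<And>m t. (\<lambda>n. f m (t + s n)) \<longlonglongrightarrow> g m t"
    "\<And>m t. (\<lambda>n. g m (t - s n)) \<longlonglongrightarrow> f m t"
    unfolding automorphic_along_def by metis
  have "uniformly_Cauchy_on UNIV g"
    unfolding uniformly_Cauchy_on_def
  proof (intro allI impI)
    fix e :: real assume "e > 0"
    have "uniformly_Cauchy_on UNIV f"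
      using unif uniformly_convergent_Cauchy uniformly_convergent_on_def by blast
    then obtain M where M: "\<And>t m n. \<lbrakk>m \<ge> M; n \<ge> M\<rbrakk> \<Longrightarrow> dist (f m t) (f n t) < e/2"
      unfolding uniformly_Cauchy_on_def using \<open>e > 0\<close> by (meson UNIV_I half_gt_zero)
    have "dist (g m t) (g n t) < e" if "m \<ge> M" "n \<ge> M" for m n t
    proof -
      have "dist (g m t) (g n t) \<le> e/2"
        by (rule tendsto_upperbound[OF tendsto_dist[OF g(1) g(1)]])
          (use M[OF that] in \<open>auto intro: always_eventually less_imp_le\<close>)
      then show ?thesis using \<open>e > 0\<close> by simp
    qed
    then show "\<exists>M. \<forall>x\<in>UNIV. \<forall>m\<ge>M. \<forall>n\<ge>M. dist (g m x) (g n x) < e"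
      by blast
  qed
  then obtain G where G: "uniform_limit UNIV g G sequentially"
    using Cauchy_uniformly_convergent uniformly_convergent_on_def by blast
  have "(\<lambda>n. F (t + s n)) \<longlonglongrightarrow> G t" for t
  proof (rule swap_uniform_limit'
        [where f = "\<lambda>m n. f m (t + s n)" and F = sequentially and S = UNIV])
    show "\<forall>\<^sub>F m in sequentially. (\<lambda>n. f m (t + s n)) \<longlonglongrightarrow> g m t"
      using g(1) by (intro always_eventually allI)
    show "uniform_limit UNIV (\<lambda>m n. f m (t + s n)) (\<lambda>n. F (t + s n)) sequentially"
      using unif by (auto simp: uniform_limit_iff elim!: eventually_mono)
  qed (use g(1) tendsto_uniform_limitI[OF G] in auto)
  moreover have "(\<lambda>n. G (t - s n)) \<longlonglongrightarrow> F t" for t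
  proof (rule swap_uniform_limit'
        [where f = "\<lambda>m n. g m (t - s n)" and F = sequentially and S = UNIV])
    show "\<forall>\<^sub>F m in sequentially. (\<lambda>n. g m (t - s n)) \<longlonglongrightarrow> f m t"
      using g(2) by (intro always_eventually allI)
    show "uniform_limit UNIV (\<lambda>m n. g m (t - s n)) (\<lambda>n. G (t - s n)) sequentially"
      using G by (auto simp: uniform_limit_iff elim!: eventually_mono)
  qed (use g(2) tendsto_uniform_limitI[OF unif] in auto)
  ultimately show ?thesis
    unfolding automorphic_along_def by blast
qed

lemma AA_add:
  assumes "f \<in> AA" "f' \<in> AA"
  shows "(\<lambda>t. f t + f' t) \<in> AA"
  unfolding AA_iff
proof (intro conjI allI)
  show "continuous_on UNIV (\<lambda>t. f t + f' t)"
    using assms by (auto simp: AA_iff intro: continuous_on_add)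
  fix s :: "nat \<Rightarrow> real"
  obtain k where k: "strict_mono k" "automorphic_along (s \<circ> k) f"
    using assms(1) AA_iff by blast
  obtain l where l: "strict_mono l" "automorphic_along ((s \<circ> k) \<circ> l) f'"
    using assms(2) AA_iff by blast
  have "automorphic_along (s \<circ> (k \<circ> l)) (\<lambda>t. f t + f' t)"
    using automorphic_along_add[OF automorphic_along_subseq[OF k(2) l(1)] l(2)]
    by (simp add: comp_assoc)
  then show "\<exists>k. strict_mono k \<and> automorphic_along (s \<circ> k) (\<lambda>t. f t + f' t)"
    using strict_mono_o[OF k(1) l(1)] by blast
qed

lemma AA_compose:
  assumes "f \<in> AA" "continuous_on UNIV P"
  shows "(\<lambda>t. P (f t)) \<in> AA"
  using assms automorphic_along_compose[OF _ assms(2)]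
  unfolding AA_iff by (metis continuous_on_compose2 subset_UNIV)

text \<open>A diagonal subsequence serves all members of the approximating sequence at once.\<close>

lemma AA_uniform_limit:
  assumes AA: "\<And>m. f m \<in> AA" and unif: "uniform_limit UNIV f F sequentially"
  shows "F \<in> AA"
  unfolding AA_iff
proof (intro conjI allI)
  show "continuous_on UNIV F"
    using AA by (intro uniform_limit_theorem[OF _ unif]) (auto simp: AA_iff)
  fix s :: "nat \<Rightarrow> real"
  interpret subseqs "\<lambda>m k. automorphic_along (s \<circ> k) (f m)"
  proof
    fix m and k :: "nat \<Rightarrow> nat"
    show "\<exists>l. strict_mono l \<and> automorphic_along (s \<circ> (k \<circ> l)) (f m)"
      using AA[of m] unfolding AA_iff by (metis comp_assoc)
  qed
  have "automorphic_along (s \<circ> (diagseq \<circ> (+) (Suc m))) (f m)" for m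
    by (rule diagseq_holds) (metis automorphic_along_subseq comp_assoc)
  then have "automorphic_along (s \<circ> diagseq) (f m)" for m
    by (metis automorphic_along_offset comp_assoc)
  then have "automorphic_along (s \<circ> diagseq) F"
    using unif by (rule automorphic_along_uniform_limit)
  then show "\<exists>k. strict_mono k \<and> automorphic_along (s \<circ> k) F"
    using subseq_diagseq by blast
qed

definition AA_bcontfun :: "(real \<Rightarrow>\<^sub>C 'a::banach) set" where
  "AA_bcontfun = {f. apply_bcontfun f \<in> AA}"

lemma subspace_AA_bcontfun: "subspace AA_bcontfun"
proof (rule subspaceI)
  show "0 \<in> AA_bcontfun"
    by (auto simp: AA_bcontfun_def AA_iff automorphic_along_def zero_bcontfun.rep_eq
        intro: strict_mono_id exI[of _ "\<lambda>_. 0"])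
next
  fix x y :: "real \<Rightarrow>\<^sub>C 'a" assume "x \<in> AA_bcontfun" "y \<in> AA_bcontfun"
  then show "x + y \<in> AA_bcontfun"
    using AA_add by (auto simp: AA_bcontfun_def plus_bcontfun.rep_eq)
next
  fix c and x :: "real \<Rightarrow>\<^sub>C 'a" assume "x \<in> AA_bcontfun"
  then show "c *\<^sub>R x \<in> AA_bcontfun"
    using AA_compose[of x "(*\<^sub>R) c"]
    by (simp add: AA_bcontfun_def scaleR_bcontfun.rep_eq continuous_on_scaleR)
qed

lemma closed_AA_bcontfun: "closed AA_bcontfun"
  unfolding closed_sequential_limits
proof (intro allI impI, elim conjE)
  fix f :: "nat \<Rightarrow> real \<Rightarrow>\<^sub>C 'a" and F
  assume "\<forall>n. f n \<in> AA_bcontfun" "f \<longlonglongrightarrow> F"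
  then have "uniform_limit UNIV (\<lambda>n. apply_bcontfun (f n)) (apply_bcontfun F) sequentially"
    "apply_bcontfun (f n) \<in> AA" for n
    by (auto simp: AA_bcontfun_def intro: tendsto_bcontfun_uniform_limit)
  then have "apply_bcontfun F \<in> AA"
    by (rule AA_uniform_limit[rotated])
  then show "F \<in> AA_bcontfun"
    by (simp add: AA_bcontfun_def)
qed

section \<open>Functions with vanishing weighted mean\<close>

definition weighted_mean :: "(real \<Rightarrow> real) \<Rightarrow> (real \<Rightarrow> real) \<Rightarrow> real \<Rightarrow> real" where
  "weighted_mean \<rho> u r = 1 / weight_mass r \<rho> * (LINT t:{-r..r}|lebesgue. u t * \<rho> t)"

lemma M0_iff: "f \<in> M0 \<rho> \<longleftrightarrow> (weighted_mean \<rho> (\<lambda>t. norm (apply_bcontfun f t)) \<longlongrightarrow> 0) at_top"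
  by (simp add: M0_def weighted_mean_def[abs_def])

lemma set_integrable_weight:
  assumes "\<rho> \<in> weights" "continuous_on UNIV u" "\<And>t. \<bar>u t\<bar> \<le> B"
  shows "set_integrable lebesgue {-r..r} (\<lambda>t. u t * \<rho> t :: real)"
proof -
  have \<rho>: "set_integrable lebesgue {-r..r} \<rho>"
    using assms(1) by (auto simp: weights_def)
  have u: "u \<in> borel_measurable lebesgue"
    using borel_measurable_continuous_onI[OF assms(2)] by (intro measurable_completion) simp
  have "set_integrable lebesgue {-r..r} (\<lambda>t. B * \<rho> t)"
    using \<rho> by simp
  then show ?thesis
    unfolding set_integrable_def
  proof (rule Bochner_Integration.integrable_bound)
    have "(\<lambda>t. u t * (indicat_real {-r..r} t *\<^sub>R \<rho> t)) \<in> borel_measurable lebesgue"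
      using u \<rho> unfolding set_integrable_def by (intro borel_measurable_times) auto
    then show "(\<lambda>t. indicat_real {-r..r} t *\<^sub>R (u t * \<rho> t)) \<in> borel_measurable lebesgue"
      by (simp add: mult.left_commute)
    have "\<bar>u t\<bar> \<le> \<bar>B\<bar>" for t
      using assms(3)[of t] by linarith
    then show "AE t in lebesgue. norm (indicat_real {-r..r} t *\<^sub>R (u t * \<rho> t))
        \<le> norm (indicat_real {-r..r} t *\<^sub>R (B * \<rho> t))"
      by (intro always_eventually allI) (auto simp: abs_mult indicator_def intro: mult_right_mono)
  qed
qed

lemma weight_mass_nonneg: "\<rho> \<in> weights \<Longrightarrow> 0 \<le> weight_mass r \<rho>"
  unfolding weight_mass_def set_lebesgue_integral_def
  by (intro integral_nonneg_AE always_eventually) (auto simp: weights_def)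

lemma weighted_mean_nonneg:
  assumes "\<rho> \<in> weights" "\<And>t. 0 \<le> u t"
  shows "0 \<le> weighted_mean \<rho> u r"
proof -
  have "0 \<le> (LINT t:{-r..r}|lebesgue. u t * \<rho> t)"
    unfolding set_lebesgue_integral_def using assms
    by (intro integral_nonneg_AE always_eventually) (auto simp: weights_def)
  then show ?thesis
    using weight_mass_nonneg[OF assms(1), of r] by (simp add: weighted_mean_def)
qed

text \<open>
  A bound is allowed to involve two functions of vanishing mean, one of them with a factor, and an
  arbitrarily small constant, because stability of \<open>M0 \<rho>\<close> under sums, under domination and under
  uniform limits are then all instances. The constant \<open>e\<close> is harmless since the weighted mean of
  a nonnegative constant is at most that constant.
\<close>

lemma vanishing_mean_dominated:
  fixes u :: "real \<Rightarrow> real"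
  assumes \<rho>: "\<rho> \<in> weights"
    and u: "continuous_on UNIV u" "\<And>t. 0 \<le> u t" "\<And>t. u t \<le> B"
    and dom: "\<And>e. e > 0 \<Longrightarrow> \<exists>v w. v \<in> M0 \<rho> \<and> w \<in> M0 \<rho> \<and>
      (\<forall>t. u t \<le> C * norm (apply_bcontfun (v :: real \<Rightarrow>\<^sub>C 'a::banach) t)
                   + norm (apply_bcontfun (w :: real \<Rightarrow>\<^sub>C 'a) t) + e)"
  shows "(weighted_mean \<rho> u \<longlongrightarrow> 0) at_top"
proof (rule tendstoI)
  fix e :: real assume "e > 0"
  then obtain v w :: "real \<Rightarrow>\<^sub>C 'a" where vw: "v \<in> M0 \<rho>" "w \<in> M0 \<rho>"
    and le: "\<And>t. u t \<le> C * norm (apply_bcontfun v t) + norm (apply_bcontfun w t) + e/2"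
    using dom[of "e/2"] half_gt_zero by metis
  let ?v = "\<lambda>t. norm (apply_bcontfun v t)" and ?w = "\<lambda>t. norm (apply_bcontfun w t)"
  have int: "set_integrable lebesgue {-r..r} (\<lambda>t. norm (apply_bcontfun f t) * \<rho> t)"
    for f :: "real \<Rightarrow>\<^sub>C 'a" and r
    by (rule set_integrable_weight[OF \<rho>, of _ "norm f"])
      (auto intro!: continuous_intros norm_bounded)
  have int_\<rho>: "set_integrable lebesgue {-r..r} \<rho>" for r
    using \<rho> by (auto simp: weights_def)
  have int_u: "set_integrable lebesgue {-r..r} (\<lambda>t. u t * \<rho> t)" for r
    by (rule set_integrable_weight[OF \<rho> u(1), of B]) (use u in auto)
  have mean_le: "weighted_mean \<rho> u r
      \<le> C * weighted_mean \<rho> ?v r + weighted_mean \<rho> ?w r + e/2" for r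
  proof -
    have "(LINT t:{-r..r}|lebesgue. u t * \<rho> t)
        \<le> (LINT t:{-r..r}|lebesgue. C * (?v t * \<rho> t) + ?w t * \<rho> t + e/2 * \<rho> t)"
    proof (rule set_integral_mono)
      fix t
      have "u t * \<rho> t \<le> (C * ?v t + ?w t + e/2) * \<rho> t"
        using \<rho> by (intro mult_right_mono le) (auto simp: weights_def)
      then show "u t * \<rho> t \<le> C * (?v t * \<rho> t) + ?w t * \<rho> t + e/2 * \<rho> t"
        by (simp add: algebra_simps)
    qed (intro int_u set_integral_add set_integrable_mult_right int int_\<rho>)+
    also have "\<dots> = C * (LINT t:{-r..r}|lebesgue. ?v t * \<rho> t)
        + (LINT t:{-r..r}|lebesgue. ?w t * \<rho> t) + e/2 * weight_mass r \<rho>"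
      using int[of r v] int[of r w] int_\<rho>[of r]
      by (simp add: set_integral_add weight_mass_def del: times_divide_eq_left)
    finally have "weighted_mean \<rho> u r \<le> 1 / weight_mass r \<rho> *
        (C * (LINT t:{-r..r}|lebesgue. ?v t * \<rho> t)
        + (LINT t:{-r..r}|lebesgue. ?w t * \<rho> t) + e/2 * weight_mass r \<rho>)"
      unfolding weighted_mean_def using weight_mass_nonneg[OF \<rho>, of r]
      by (intro mult_left_mono) auto
    also have "\<dots> = C * weighted_mean \<rho> ?v r + weighted_mean \<rho> ?w r
        + e/2 * (weight_mass r \<rho> / weight_mass r \<rho>)"
      unfolding weighted_mean_def by (simp add: algebra_simps add_divide_distrib)
    \<comment> \<open>For a radius of zero mass the quotient is \<open>0 / 0 = 0\<close>, and the bound persists.\<close>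
    also have "\<dots> \<le> C * weighted_mean \<rho> ?v r + weighted_mean \<rho> ?w r + e/2"
      using \<open>e > 0\<close> by (cases "weight_mass r \<rho> = 0") auto
    finally show ?thesis .
  qed
  have "((\<lambda>r. C * weighted_mean \<rho> ?v r + weighted_mean \<rho> ?w r + e/2)
      \<longlongrightarrow> C * 0 + 0 + e/2) at_top"
    using vw by (intro tendsto_intros) (auto simp: M0_iff)
  from order_tendstoD(2)[OF this, of e]
  have "\<forall>\<^sub>F r in at_top. C * weighted_mean \<rho> ?v r + weighted_mean \<rho> ?w r + e/2 < e"
    using \<open>e > 0\<close> by simp
  then show "\<forall>\<^sub>F r in at_top. dist (weighted_mean \<rho> u r) 0 < e"
  proof eventually_elim
    case (elim r)
    then show ?case
      using mean_le[of r] weighted_mean_nonneg[OF \<rho>, of u r] u(2) by simp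
  qed
qed

lemma M0_dominated:
  fixes f :: "real \<Rightarrow>\<^sub>C 'a::banach"
  assumes "\<rho> \<in> weights"
    and "\<And>e. e > 0 \<Longrightarrow> \<exists>v w. v \<in> M0 \<rho> \<and> w \<in> M0 \<rho> \<and>
      (\<forall>t. norm (apply_bcontfun f t) \<le> C * norm (apply_bcontfun (v :: real \<Rightarrow>\<^sub>C 'a) t)
                   + norm (apply_bcontfun (w :: real \<Rightarrow>\<^sub>C 'a) t) + e)"
  shows "f \<in> M0 \<rho>"
  unfolding M0_iff
  by (rule vanishing_mean_dominated[OF assms(1) _ _ norm_bounded assms(2)])
    (auto intro!: continuous_intros norm_bounded)

lemma zero_in_M0: "0 \<in> M0 \<rho>"
  by (simp add: M0_def zero_bcontfun.rep_eq set_lebesgue_integral_def)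

lemma M0_dominated_multiple:
  fixes f v :: "real \<Rightarrow>\<^sub>C 'a::banach"
  assumes "\<rho> \<in> weights" "v \<in> M0 \<rho>"
    and "\<And>t. norm (apply_bcontfun f t) \<le> C * norm (apply_bcontfun v t)"
  shows "f \<in> M0 \<rho>"
  by (rule M0_dominated[OF assms(1), of _ C], rule exI[of _ v], rule exI[of _ 0])
    (use assms in \<open>auto simp: zero_in_M0 intro: add_increasing2\<close>)

lemma subspace_M0:
  assumes "\<rho> \<in> weights"
  shows "subspace (M0 \<rho> :: (real \<Rightarrow>\<^sub>C 'a::banach) set)"
proof (rule subspaceI)
  show "0 \<in> M0 \<rho>" by (rule zero_in_M0)
next
  fix x y :: "real \<Rightarrow>\<^sub>C 'a" assume xy: "x \<in> M0 \<rho>" "y \<in> M0 \<rho>"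
  show "x + y \<in> M0 \<rho>"
    by (rule M0_dominated[OF assms, of _ 1], rule exI[of _ x], rule exI[of _ y])
      (use xy in \<open>auto simp: plus_bcontfun.rep_eq intro: add_increasing2 norm_triangle_ineq\<close>)
next
  fix c and x :: "real \<Rightarrow>\<^sub>C 'a" assume "x \<in> M0 \<rho>"
  then show "c *\<^sub>R x \<in> M0 \<rho>"
    by (rule M0_dominated_multiple[OF assms, of _ _ "\<bar>c\<bar>"]) (simp add: scaleR_bcontfun.rep_eq)
qed

lemma closed_M0:
  assumes "\<rho> \<in> weights"
  shows "closed (M0 \<rho> :: (real \<Rightarrow>\<^sub>C 'a::banach) set)"
proof -
  have "F \<in> M0 \<rho>" if F: "F \<in> closure (M0 \<rho>)" for F :: "real \<Rightarrow>\<^sub>C 'a"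
  proof (rule M0_dominated[OF assms, of _ 1])
    fix e :: real assume "e > 0"
    then obtain f where f: "f \<in> M0 \<rho>" "dist f F < e"
      using F closure_approachable by blast
    have "norm (apply_bcontfun F t) \<le> 1 * norm (apply_bcontfun f t) + norm (apply_bcontfun 0 t) + e"
      for t
    proof -
      have "norm (apply_bcontfun F t) - norm (apply_bcontfun f t)
          \<le> dist (apply_bcontfun f t) (apply_bcontfun F t)"
        by (metis dist_norm norm_minus_commute norm_triangle_ineq2)
      also have "\<dots> \<le> dist f F" by (rule dist_bounded)
      finally show ?thesis using f(2) by (simp add: zero_bcontfun.rep_eq)
    qed
    then show "\<exists>v w. v \<in> M0 \<rho> \<and> w \<in> M0 \<rho> \<and> (\<forall>t. norm (apply_bcontfun F t)
        \<le> 1 * norm (apply_bcontfun v t) + norm (apply_bcontfun (w :: real \<Rightarrow>\<^sub>C 'a) t) + e)"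
      using f(1) zero_in_M0 by (intro exI[of _ f] exI[of _ 0]) simp
  qed
  then show ?thesis
    using closure_subset_eq by blast
qed

section \<open>Bounded decompositions\<close>

definition radial_retraction :: "real \<Rightarrow> 'a::real_normed_vector \<Rightarrow> 'a" where
  "radial_retraction c x = (c / max c (norm x)) *\<^sub>R x"

lemma radial_retraction_ident: "\<lbrakk>c > 0; norm x \<le> c\<rbrakk> \<Longrightarrow> radial_retraction c x = x"
  by (simp add: radial_retraction_def max_def)

lemma norm_radial_retraction_le: "c > 0 \<Longrightarrow> norm (radial_retraction c x) \<le> c"
  by (simp add: radial_retraction_def max_def field_simps)

lemma radial_retraction_lipschitz:
  assumes "c > 0"
  shows "norm (radial_retraction c x - radial_retraction c y) \<le> 2 * norm (x - y)"
proof -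
  define a b where "a = max c (norm x)" and "b = max c (norm y)"
  have ab: "a \<ge> c" "b \<ge> c" "norm y \<le> b" "a > 0" "b > 0" "\<bar>b - a\<bar> \<le> norm (x - y)"
    using assms norm_triangle_ineq3[of x y] by (auto simp: a_def b_def max_def)
  \<comment> \<open>The first summand is the change of the point, the second that of the scaling factor; each
    contributes at most \<open>norm (x - y)\<close>.\<close>
  have "radial_retraction c x - radial_retraction c y
      = (c/a) *\<^sub>R (x - y) + (c/a * ((b - a) / b)) *\<^sub>R y"
    using ab by (simp add: radial_retraction_def flip: a_def b_def)
      (simp add: scaleR_diff_right diff_divide_distrib right_diff_distrib scaleR_diff_left)
  also have "norm \<dots> \<le> \<bar>c/a\<bar> * norm (x - y) + \<bar>c/a * ((b - a) / b)\<bar> * norm y"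
    by (metis norm_scaleR norm_triangle_ineq)
  also have "\<dots> \<le> norm (x - y) + \<bar>b - a\<bar>"
  proof (intro add_mono)
    have ca: "\<bar>c/a\<bar> \<le> 1"
      using ab assms by simp
    show "\<bar>c/a\<bar> * norm (x - y) \<le> norm (x - y)"
      using mult_right_mono[OF ca norm_ge_zero, of "x - y"] by simp
    have "\<bar>c/a * ((b - a) / b)\<bar> * norm y = \<bar>c/a\<bar> * (\<bar>b - a\<bar> * (norm y / b))"
      using ab by (simp add: abs_mult)
    also have "\<dots> \<le> 1 * (\<bar>b - a\<bar> * 1)"
      using ab ca by (intro mult_mono) auto
    finally show "\<bar>c/a * ((b - a) / b)\<bar> * norm y \<le> \<bar>b - a\<bar>" by simp
  qed
  also have "\<dots> \<le> 2 * norm (x - y)"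
    using ab by simp
  finally show ?thesis .
qed

lemma continuous_radial_retraction: "c > 0 \<Longrightarrow> continuous_on UNIV (radial_retraction c)"
  unfolding radial_retraction_def by (intro continuous_intros) (auto simp: max_def)

text \<open>
  Retracting the almost automorphic component onto the ball of radius \<open>c\<close> leaves \<open>f\<close> itself
  unchanged and increases the ergodic component at most by the Lipschitz constant.
\<close>

lemma bounded_decomposition:
  fixes f g :: "real \<Rightarrow>\<^sub>C 'a::banach"
  assumes \<rho>: "\<rho> \<in> weights" and "c > 0" "norm f \<le> c" "g \<in> AA_bcontfun" "f - g \<in> M0 \<rho>"
  shows "\<exists>g'\<in>AA_bcontfun. norm g' \<le> c \<and> f - g' \<in> M0 \<rho>"
proof -
  let ?P = "radial_retraction c :: 'a \<Rightarrow> 'a"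
  define g' where "g' = Bcontfun (\<lambda>t. ?P (apply_bcontfun g t))"
  have AA: "(\<lambda>t. ?P (apply_bcontfun g t)) \<in> AA"
    using assms continuous_radial_retraction by (auto simp: AA_bcontfun_def dest: AA_compose)
  then have "(\<lambda>t. ?P (apply_bcontfun g t)) \<in> bcontfun"
    using norm_radial_retraction_le[OF \<open>c > 0\<close>] by (intro bcontfun_normI) (auto simp: AA_iff)
  then have g': "apply_bcontfun g' = (\<lambda>t. ?P (apply_bcontfun g t))"
    by (simp add: g'_def Bcontfun_inverse)
  then have "g' \<in> AA_bcontfun"
    using AA by (simp add: AA_bcontfun_def)
  moreover have "norm g' \<le> c"
    using norm_radial_retraction_le[OF \<open>c > 0\<close>] by (intro norm_bound) (simp add: g')
  moreover have "f - g' \<in> M0 \<rho>"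
  proof (rule M0_dominated_multiple[OF \<rho> \<open>f - g \<in> M0 \<rho>\<close>])
    fix t
    have "?P (apply_bcontfun f t) = apply_bcontfun f t"
      using norm_bounded[of f t] assms by (intro radial_retraction_ident) auto
    then show "norm (apply_bcontfun (f - g') t) \<le> 2 * norm (apply_bcontfun (f - g) t)"
      using radial_retraction_lipschitz[OF \<open>c > 0\<close>, of "apply_bcontfun f t" "apply_bcontfun g t"]
      by (simp add: minus_bcontfun.rep_eq g')
  qed
  ultimately show ?thesis by blast
qed

section \<open>Weighted pseudo almost automorphic functions\<close>

text \<open>The almost automorphic component of a bounded function is itself bounded, as \<open>g = f - h\<close>.\<close>

lemma PAA_eq_sum: "PAA \<rho> = {g + h | g h. g \<in> AA_bcontfun \<and> h \<in> M0 \<rho>}"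
proof (intro equalityI subsetI)
  fix f :: "real \<Rightarrow>\<^sub>C 'a" assume "f \<in> PAA \<rho>"
  then obtain g h where gh: "g \<in> AA" "h \<in> M0 \<rho>"
    and f: "\<And>t. apply_bcontfun f t = g t + apply_bcontfun h t"
    by (auto simp: PAA_def)
  have "apply_bcontfun (f - h) = g"
    by (simp add: fun_eq_iff minus_bcontfun.rep_eq f)
  then have "f - h \<in> AA_bcontfun"
    using gh by (simp add: AA_bcontfun_def)
  then show "f \<in> {g + h | g h. g \<in> AA_bcontfun \<and> h \<in> M0 \<rho>}"
    using gh by (intro CollectI exI[of _ "f - h"] exI[of _ h]) simp
next
  fix f :: "real \<Rightarrow>\<^sub>C 'a" assume "f \<in> {g + h | g h. g \<in> AA_bcontfun \<and> h \<in> M0 \<rho>}"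
  then show "f \<in> PAA \<rho>"
    by (force simp: PAA_def AA_bcontfun_def plus_bcontfun.rep_eq)
qed

theorem theorem2p3:
  fixes \<rho> :: "real \<Rightarrow> real"
  assumes "\<rho> \<in> weights_infty"
  shows "subspace (PAA \<rho> :: (real \<Rightarrow>\<^sub>C 'a::banach) set)
    \<and> (\<forall>f \<in> (PAA \<rho> :: (real \<Rightarrow>\<^sub>C 'a) set). norm f = (SUP t. norm (apply_bcontfun f t)))
    \<and> complete (PAA \<rho> :: (real \<Rightarrow>\<^sub>C 'a) set)"
proof (intro conjI ballI)
  have \<rho>: "\<rho> \<in> weights"
    using assms by (simp add: weights_infty_def)
  show "subspace (PAA \<rho> :: (real \<Rightarrow>\<^sub>C 'a) set)"
    unfolding PAA_eq_sum
    using subspace_sums[OF subspace_AA_bcontfun subspace_M0[OF \<rho>]] by simp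
  show "norm f = (SUP t. norm (apply_bcontfun f t))" for f :: "real \<Rightarrow>\<^sub>C 'a"
    by (simp add: norm_bcontfun_def dist_bcontfun_def zero_bcontfun.rep_eq)
  have "closed (PAA \<rho> :: (real \<Rightarrow>\<^sub>C 'a) set)"
    unfolding PAA_eq_sum
  proof (rule closed_sum_of_subspaces)
    fix c :: real and f :: "real \<Rightarrow>\<^sub>C 'a"
    assume "c > 0" "f \<in> {g + h | g h. g \<in> AA_bcontfun \<and> h \<in> M0 \<rho>}" "norm f \<le> c"
    moreover from this(2) obtain g where "g \<in> AA_bcontfun" "f - g \<in> M0 \<rho>"
      by auto
    ultimately show "\<exists>g\<in>AA_bcontfun. norm g \<le> c \<and> f - g \<in> M0 \<rho>"
      using bounded_decomposition[OF \<rho>] by blast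
  qed (use \<rho> in \<open>simp_all add: subspace_AA_bcontfun closed_AA_bcontfun subspace_M0 closed_M0\<close>)
  then show "complete (PAA \<rho> :: (real \<Rightarrow>\<^sub>C 'a) set)"
    by (simp add: complete_eq_closed)
qed

end
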